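(* Let $X,Y$ be types (sets), and let $f:X\to Y$ and $g:L\,Y\to Y$ be functions. For every natural number $n$ we have $\mathit{td}\;n=\mathit{bu}\;n$ as functions on lists over $X$ of length exactly $1+n$, where $$\mathit{bu}\;n=\mathit{unT}\circ(\mathrm{map}_B\,g\circ\mathit{up})^{n}\circ\mathrm{map}_B\,\mathit{ex}\circ\mathit{ch}\;1\circ\mathrm{map}_L\,f .$$ That is, for every list $xs$ over $X$ with $\mathrm{length}(xs)=1+n$, both sides are defined at $xs$ and $\mathit{td}\;n\;xs=\mathit{bu}\;n\;xs$. Here $\mathit{td}$, $\mathit{unT}$, $\mathit{up}$, $\mathit{ex}$, $\mathit{ch}$, $\mathrm{map}_B$, $\mathrm{map}_L$ are as defined in the context.
   Context: $L\,a$ is the type of finite lists over $a$; $x:xs$ is cons, $\mathbin{+\!\!+}$ is list append, $\mathrm{map}_L$ is the map function of lists. $\mathit{ex}:L\,a\to a$ is the partial function with $\mathit{ex}\,[x]=x$, defined only on singleton lists. For a (partial) function $s$, $s^0=\mathrm{id}$ and $s^{1+k}=s^k\circ s$. Immediate sublists, $\mathit{subs}: L\,a\to L(L\,a)$: - $\mathit{subs}\;[\,]=[\,]$, - $\mathit{subs}\;(x:xs)=\mathrm{map}_L\,(x:)\,(\mathit{subs}\;xs)\mathbin{+\!\!+}[xs]$. Top-down algorithm, for given $f:X\to Y$ and $g:L\,Y\to Y$: $\mathit{td}:\mathbb N\to L\,X\to Y$, where $\mathit{td}\;n$ is regarded as a function on lists of length exactly $1+n$: - $\mathit{td}\;0=f\circ\mathit{ex}$,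 - $\mathit{td}\;(1+n)=g\circ\mathrm{map}_L(\mathit{td}\;n)\circ\mathit{subs}$. Trees: $B\,a$ is the inductive type of tip-valued binary trees with constructors $T: a\to B\,a$ and $N: B\,a\to B\,a\to B\,a$. $\mathrm{map}_B\,f$ applies $f$ to the value at every tip. $\mathit{zipBW}: (a\to b\to c)\to B\,a\to B\,b\to B\,c$ combines two trees of the same shape by applying the given function to the values at corresponding tips; it is undefined if the shapes differ. $\mathit{unT}\,(T\,p)=p$ (undefined on $N$-trees). $\mathit{snoc}\;ys\;z=ys\mathbin{+\!\!+}[z]$. In all definitions, clauses are tried from top to bottom and the first matching one applies. $\mathit{ch}:\mathbb N\to L\,a\to B(L\,a)$, with $\mathit{ch}\;k\;xs$ defined when $k\le\mathrm{length}(xs)$: - $\mathit{ch}\;0\;xs=T\,[\,]$, - $\mathit{ch}\;k\;xs=T\,xs$ if $k=\mathrm{length}(xs)$, - $\mathit{ch}\;(1+k)\;(x:xs)=N\,(\mathrm{map}_B\,(x:)\,(\mathit{ch}\;k\;xs))\,(\mathit{ch}\;(1+k)\;xs)$. The partial function $\mathit{up}: B\,a\to B(L\,a)$ (polymorphic in $a$): - $\mathit{up}\,(N\,(T\,p)\,(T\,q))=T\,[p,q]$, - $\mathit{up}\,(N\,t\,(T\,q))=T\,(\mathit{unT}(\mathit{up}\,t)\mathbin{+\!\!+}[q])$, - $\mathit{up}\,(N\,(T\,p)\,u)=N\,(\mathrm{map}_B\,(\lambda q.\,[p,q])\,u)\,(\mathit{up}\,u)$, - $\mathit{up}\,(N\,t\,u)=N\,(\mathit{zipBW}\;\mathit{snoc}\;(\mathit{up}\,t)\;u)\,(\mathit{up}\,u)$,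 and $\mathit{up}\,(T\,p)$ is undefined. *)

theory Defs
  imports Main "HOL-Library.Monad_Syntax"
begin

text \<open>
  Partial functions are maps \<open>'a \<rightharpoonup> 'b\<close>, where \<open>None\<close> means undefined. They are composed with
  \<open>\<circ>\<^sub>m\<close>; a total function \<open>h\<close> enters such a composition as \<open>Some \<circ> h\<close>. Application is strict:
  an expression is undefined as soon as one of its subexpressions is.
\<close>

fun ex :: "'a list \<rightharpoonup> 'a" where
  "ex [x] = Some x"
| "ex _ = None"

primrec ppow :: "('a \<rightharpoonup> 'a) \<Rightarrow> nat \<Rightarrow> 'a \<rightharpoonup> 'a" where
  "ppow s 0 = Some"
| "ppow s (Suc k) = ppow s k \<circ>\<^sub>m s"

text \<open>Mapping a partial function over a list: defined iff the function is defined at every element.\<close>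

definition pmap_L :: "('a \<rightharpoonup> 'b) \<Rightarrow> 'a list \<rightharpoonup> 'b list" where
  "pmap_L h xs = those (map h xs)"

primrec subs :: "'a list \<Rightarrow> 'a list list" where
  "subs [] = []"
| "subs (x # xs) = map ((#) x) (subs xs) @ [xs]"

text \<open>
  \<open>td f g n\<close> is meant for lists of length \<open>1 + n\<close>; its values at lists of other lengths, where
  the clauses happen to produce any, are irrelevant.
\<close>

primrec td :: "('x \<Rightarrow> 'y) \<Rightarrow> ('y list \<Rightarrow> 'y) \<Rightarrow> nat \<Rightarrow> 'x list \<rightharpoonup> 'y" where
  "td f g 0 = (Some \<circ> f) \<circ>\<^sub>m ex"
| "td f g (Suc n) = (Some \<circ> g) \<circ>\<^sub>m pmap_L (td f g n) \<circ>\<^sub>m (Some \<circ> subs)"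

text \<open>The map function \<open>map_B\<close> for total functions is generated by the datatype command.\<close>

datatype 'a B = T 'a | N "'a B" "'a B"

fun pmap_B :: "('a \<rightharpoonup> 'b) \<Rightarrow> 'a B \<rightharpoonup> 'b B" where
  "pmap_B h (T a) = do { b \<leftarrow> h a; Some (T b) }"
| "pmap_B h (N t u) = do { t' \<leftarrow> pmap_B h t; u' \<leftarrow> pmap_B h u; Some (N t' u') }"

fun zipBW :: "('a \<Rightarrow> 'b \<Rightarrow> 'c) \<Rightarrow> 'a B \<Rightarrow> 'b B \<rightharpoonup> 'c B" where
  "zipBW h (T a) (T b) = Some (T (h a b))"
| "zipBW h (N t u) (N t' u') = do { v \<leftarrow> zipBW h t t'; w \<leftarrow> zipBW h u u'; Some (N v w) }"
| "zipBW h _ _ = None"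

fun unT :: "'a B \<rightharpoonup> 'a" where
  "unT (T p) = Some p"
| "unT (N _ _) = None"

definition snoc :: "'a list \<Rightarrow> 'a \<Rightarrow> 'a list" where
  "snoc ys z = ys @ [z]"

fun ch :: "nat \<Rightarrow> 'a list \<rightharpoonup> 'a list B" where
  "ch 0 xs = Some (T [])"
| "ch (Suc k) [] = None"
| "ch (Suc k) (x # xs) =
    (if Suc k = length (x # xs) then Some (T (x # xs))
     else do { t \<leftarrow> ch k xs; u \<leftarrow> ch (Suc k) xs; Some (N (map_B ((#) x) t) u) })"

fun up :: "'a B \<rightharpoonup> 'a list B" where
  "up (N (T p) (T q)) = Some (T [p, q])"
| "up (N t (T q)) = do { t' \<leftarrow> up t; ys \<leftarrow> unT t'; Some (T (ys @ [q])) }"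
| "up (N (T p) u) = do { u' \<leftarrow> up u; Some (N (map_B (\<lambda>q. [p, q]) u) u') }"
| "up (N t u) = do { t' \<leftarrow> up t; v \<leftarrow> zipBW snoc t' u; u' \<leftarrow> up u; Some (N v u') }"
| "up (T p) = None"

definition bu :: "('x \<Rightarrow> 'y) \<Rightarrow> ('y list \<Rightarrow> 'y) \<Rightarrow> nat \<Rightarrow> 'x list \<rightharpoonup> 'y" where
  "bu f g n =
    unT \<circ>\<^sub>m ppow ((Some \<circ> map_B g) \<circ>\<^sub>m up) n \<circ>\<^sub>m pmap_B ex \<circ>\<^sub>m ch 1 \<circ>\<^sub>m (Some \<circ> map f)"

end

theory Submission imports Defs
begin

text \<open>
  The key identity is that \<open>up\<close> turns the tree of \<open>k\<close>-sublists of \<open>xs\<close> into the tree of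
  \<open>(k+1)\<close>-sublists with \<open>subs\<close> applied at each tip. Since \<open>up\<close> is natural, a tree carrying the values
  of \<open>td k\<close> on the \<open>(k+1)\<close>-sublists is therefore turned by \<open>map_B g \<circ> up\<close> into the tree carrying the
  values of \<open>td (k+1)\<close> on the \<open>(k+2)\<close>-sublists; after \<open>n\<close> steps a single tip remains.
\<close>

lemma unT_map_B: "unT (map_B h t) = map_option h (unT t)"
  by (cases t) auto

lemma zipBW_map_B:
  assumes "\<And>x y. h' (a x) (b y) = c (h x y)"
  shows "zipBW h' (map_B a t) (map_B b u) = map_option (map_B c) (zipBW h t u)"
  using assms
  by (induction h t u rule: zipBW.induct) (auto simp: map_option_bind bind_map_option comp_def
      cong: Option.bind_cong)

lemma zipBW_snoc_map_B:
  "zipBW snoc (map_B (map h) t) (map_B h u) = map_option (map_B (map h)) (zipBW snoc t u)"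
  by (rule zipBW_map_B) (simp add: snoc_def)

lemma zipBW_map_B_same: "zipBW h (map_B a t) (map_B b t) = Some (map_B (\<lambda>x. h (a x) (b x)) t)"
  by (induction t) auto

lemma up_map_B: "up (map_B h t) = map_option (map_B (map h)) (up t)"
  \<comment> \<open>In the last clause of \<open>up\<close> the second tree is a node, so
    \<open>map_B\<close> has already been pushed inside it; the instance of
    \<open>zipBW_snoc_map_B\<close> matches that form.\<close>
  by (induction t rule: up.induct)
    (auto simp: map_option_bind bind_map_option comp_def unT_map_B B.map_comp
      zipBW_snoc_map_B[where u = "N _ _", unfolded B.map]
      cong: Option.bind_cong)

lemma ch_defined: "k \<le> length xs \<Longrightarrow> \<exists>t. ch k xs = Some t"
proof (induction k xs rule: ch.induct)
  case (3 k x xs)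
  then show ?case by (cases "k = length xs") auto
qed auto

lemma length_ch_tip: "ch k xs = Some t \<Longrightarrow> ys \<in> set_B t \<Longrightarrow> length ys = k"
proof (induction k xs arbitrary: t ys rule: ch.induct)
  case (3 k x xs)
  show ?case
  proof (cases "k = length xs")
    case True
    then show ?thesis using "3.prems" by auto
  next
    case False
    then obtain l r where l: "ch k xs = Some l" and r: "ch (Suc k) xs = Some r"
      and t: "t = N (map_B ((#) x) l) r"
      using "3.prems"(1) by (auto split: bind_splits)
    show ?thesis
      using "3.IH"(1)[OF _ l] "3.IH"(2)[OF _ l r] "3.prems"(2) False
      by (auto simp: t B.set_map)
  qed
qed auto

lemma ch_length: "ch (length xs) xs = Some (T xs)"
  by (cases xs) auto

text \<open>The strict bounds exclude both ways in which \<open>ch\<close> yields a tip. This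
  settles which clause of \<open>up\<close> applies below.\<close>

lemma ch_node:
  assumes "0 < k" "k < length xs"
  obtains t u where "ch k xs = Some (N t u)"
proof -
  obtain j x ys where "k = Suc j" "xs = x # ys"
    using assms by (cases k; cases xs) auto
  with ch_defined[of k xs] assms that show thesis
    by (auto split: bind_splits)
qed

lemma subs_Cons_singleton: "length ys = 1 \<Longrightarrow> subs (x # ys) = [[x], ys]"
  by (cases ys) auto

text \<open>The four cases mirror the clauses of \<open>up\<close>: the left subtree is a tip iff
  \<open>k = 1\<close>, the right one iff \<open>k\<close> is the length of the tail.\<close>

lemma up_ch:
  assumes "ch k xs = Some t" "ch (Suc k) xs = Some u" "0 < k" "k < length xs"
  shows "up t = Some (map_B subs u)"
  using assms
proof (induction xs arbitrary: k t u)
  case Nil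
  then show ?case by simp
next
  case (Cons x xs)
  obtain j where k: "k = Suc j" using Cons.prems(3) by (cases k) auto
  have j: "j < length xs" using Cons.prems(4) k by simp
  obtain l where l: "ch j xs = Some l" using ch_defined[of j xs] j by auto
  obtain r where r: "ch k xs = Some r" using ch_defined[of k xs] j k by auto
  have t: "t = N (map_B ((#) x) l) r" using Cons.prems k j l r by simp
  \<comment> \<open>Naturality moves the prefixing by \<open>x\<close> through \<open>up\<close>.
    For \<open>j = 0\<close> the tree \<open>l\<close> is a tip, where \<open>up\<close> is
    undefined.\<close>
  have up_l: "up (map_B ((#) x) l) = Some (map_B (\<lambda>q. map ((#) x) (subs q)) r)" if "0 < j"
    using Cons.IH[OF l _ that j] r k by (simp add: up_map_B B.map_comp comp_def)
  show ?case
  proof (cases "k = length xs")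
    case True
    then have r_tip: "r = T xs" and u: "u = T (x # xs)"
      using r Cons.prems ch_length[of xs] by auto
    show ?thesis
    proof (cases j)
      case 0
      then have "l = T []" and "length xs = 1" using l True k by auto
      then show ?thesis by (simp add: t r_tip u subs_Cons_singleton del: subs.simps)
    next
      case (Suc i)
      then obtain l1 l2 where "l = N l1 l2" using ch_node[of j xs] j l by auto
      with up_l Suc show ?thesis by (simp add: t r_tip u)
    qed
  next
    case False
    then have less: "k < length xs" using j k by simp
    obtain r1 r2 where r_node: "r = N r1 r2" using ch_node[of k xs] r less k by auto
    obtain v where v: "ch (Suc k) xs = Some v" using ch_defined[of "Suc k" xs] less by auto
    have u: "u = N (map_B ((#) x) r) v" using Cons.prems r v False by simp
    have up_r: "up r = Some (map_B subs v)"
      using Cons.IH[OF r v] Cons.prems less by simp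
    show ?thesis
    proof (cases j)
      case 0
      then have l_tip: "l = T []" using l by simp
      \<comment> \<open>Here \<open>k = 1\<close>, so every tip of \<open>r\<close> is a singleton
        list.\<close>
      have "map_B (\<lambda>q. [[x], q]) r = map_B (\<lambda>q. subs (x # q)) r"
        using length_ch_tip[OF r] k 0
        by (intro B.map_cong refl subs_Cons_singleton[symmetric]) simp
      with up_r show ?thesis
        by (simp add: t l_tip u r_node B.map_comp comp_def)
    next
      case (Suc i)
      then obtain l1 l2 where l_node: "l = N l1 l2" using ch_node[of j xs] j l by auto
      \<comment> \<open>Both arguments have the shape of \<open>r\<close>, so the zip is defined; at
        each tip it performs the recursion step of \<open>subs\<close>.\<close>
      have "zipBW snoc (map_B (\<lambda>q. map ((#) x) (subs q)) r) r = Some (map_B (\<lambda>q. subs (x # q)) r)"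
        using zipBW_map_B_same[of snoc "\<lambda>q. map ((#) x) (subs q)" r "\<lambda>q. q"]
        by (simp add: snoc_def B.map_ident)
      with up_l up_r Suc show ?thesis
        by (simp add: t l_node u r_node B.map_comp comp_def)
    qed
  qed
qed

text \<open>\<open>hd\<close> extends \<open>ex\<close> to a total function up to its junk value at \<open>[]\<close>, which is never used.\<close>

primrec td_total :: "('x \<Rightarrow> 'y) \<Rightarrow> ('y list \<Rightarrow> 'y) \<Rightarrow> nat \<Rightarrow> 'x list \<Rightarrow> 'y" where
  "td_total f g 0 = f \<circ> hd"
| "td_total f g (Suc n) = g \<circ> map (td_total f g n) \<circ> subs"

lemma length_subs_elem: "ys \<in> set (subs xs) \<Longrightarrow> Suc (length ys) = length xs"
  by (induction xs arbitrary: ys) auto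

lemma pmap_L_eq_Some:
  assumes "\<And>x. x \<in> set xs \<Longrightarrow> p x = Some (h x)"
  shows "pmap_L p xs = Some (map h xs)"
  using assms unfolding pmap_L_def by (induction xs) auto

lemma td_eq_td_total: "length xs = Suc n \<Longrightarrow> td f g n xs = Some (td_total f g n xs)"
proof (induction n arbitrary: xs)
  case 0
  then show ?case by (cases xs) (auto simp: map_comp_def)
next
  case (Suc n)
  have "pmap_L (td f g n) (subs xs) = Some (map (td_total f g n) (subs xs))"
    using Suc by (intro pmap_L_eq_Some) (auto dest: length_subs_elem)
  then show ?case by (simp add: map_comp_def)
qed

text \<open>All tips of \<open>ch 1\<close> are singletons, where \<open>ex\<close> is defined and
  agrees with \<open>hd\<close>.\<close>

lemma pmap_B_ex_ch_1: "ch 1 xs = Some t \<Longrightarrow>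
    ch 1 (map f xs) \<bind> pmap_B ex = Some (map_B (f \<circ> hd) t)"
proof (induction xs arbitrary: t)
  case (Cons x xs)
  show ?case
  proof (cases "xs = []")
    case False
    then obtain u where u: "ch 1 xs = Some u" using ch_defined[of 1 xs] by (cases xs) auto
    then have "t = N (T [x]) u" using Cons.prems False by simp
    with Cons.IH[OF u] False show ?thesis by (auto split: bind_splits)
  qed (use Cons.prems in auto)
qed simp

text \<open>This is the loop invariant. Since \<open>ppow\<close> performs its first step innermost,
  the induction on \<open>k\<close> must let the starting level \<open>j\<close> vary.\<close>

lemma ppow_up_td_total:
  assumes "ch (Suc j) xs = Some t" "j + k < length xs"
  shows "ppow ((Some \<circ> map_B g) \<circ>\<^sub>m up) k (map_B (td_total f g j) t)
    = map_option (map_B (td_total f g (j + k))) (ch (Suc (j + k)) xs)"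
  using assms
proof (induction k arbitrary: j t)
  case 0
  then show ?case by simp
next
  case (Suc k)
  obtain u where u: "ch (Suc (Suc j)) xs = Some u"
    using ch_defined[of "Suc (Suc j)" xs] Suc.prems by auto
  have "up t = Some (map_B subs u)"
    using up_ch[OF Suc.prems(1) u] Suc.prems by simp
  then have "((Some \<circ> map_B g) \<circ>\<^sub>m up) (map_B (td_total f g j) t)
      = Some (map_B (td_total f g (Suc j)) u)"
    by (simp add: map_comp_def up_map_B B.map_comp comp_assoc)
  then show ?case
    using Suc.IH[OF u] Suc.prems by (simp only: ppow.simps map_comp_simps add_Suc add_Suc_right)
qed

theorem theorem1:
  fixes f :: "'x \<Rightarrow> 'y" and g :: "'y list \<Rightarrow> 'y" and n :: nat and xs :: "'x list"
  assumes "length xs = 1 + n"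
  shows "xs \<in> dom (td f g n) \<and> xs \<in> dom (bu f g n) \<and> td f g n xs = bu f g n xs"
proof -
  obtain t where t: "ch 1 xs = Some t"
    using ch_defined[of 1 xs] assms by auto
  obtain s where s: "ch 1 (map f xs) = Some s" "pmap_B ex s = Some (map_B (td_total f g 0) t)"
    using pmap_B_ex_ch_1[OF t, of f] by (auto split: bind_splits)
  \<comment> \<open>Level \<open>Suc n\<close> is the full length of \<open>xs\<close>, so the last
    tree of sublists is the single tip \<open>T xs\<close>.\<close>
  have "ppow ((Some \<circ> map_B g) \<circ>\<^sub>m up) n (map_B (td_total f g 0) t) = Some (T (td_total f g n xs))"
    using ppow_up_td_total[of 0 xs t n g f] t assms ch_length[of xs] by simp
  with s have "bu f g n xs = Some (td_total f g n xs)"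
    by (simp add: bu_def map_comp_def)
  with td_eq_td_total[of xs n f g] assms show ?thesis by auto
qed

end
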